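(* Let $X$ be an $n\times p$ random matrix whose rows are i.i.d. copies of a random row vector $X_0\in\mathbb{R}^p$, let $\hat\Sigma:=X^TX/n$, $\Sigma_0:=\mathbb{E}X_0^TX_0$, $W:=\hat\Sigma-\Sigma_0$, and assume $\Theta_0:=\Sigma_0^{-1}$ exists. Let $\lambda>0$, let $\hat\Theta$ be the graphical Lasso with tuning parameter $\lambda$ as defined in the context, and let $$\hat\Theta_{\text{de-sparse}}:=2\hat\Theta-\hat\Theta\hat\Sigma\hat\Theta$$ be the de-sparsified graphical Lasso. Then there are matrices $\mathrm{rem}_1,\mathrm{rem}_2$ with $$\hat\Theta_{\text{de-sparse}}-\Theta_0=-\Theta_0W\Theta_0-\mathrm{rem}_1-\mathrm{rem}_2,$$ where $$\|\mathrm{rem}_1\|_\infty\le\|\Theta_0W\|_\infty\,|||\hat\Theta-\Theta_0|||_1,\qquad\|\mathrm{rem}_2\|_\infty\le\lambda\,|||\hat\Theta|||_1\,|||\hat\Theta-\Theta_0|||_1 .$$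
   Context: For a matrix $A$, $\|A\|_\infty:=\max_{k,j}|A_{k,j}|$ and $|||A|||_1:=\max_j\sum_k|A_{k,j}|$. The graphical Lasso is (a minimizer, assumed to exist) $$\hat\Theta=\arg\min_{\Theta}\big\{\mathrm{trace}(\hat\Sigma\Theta)-\log\det(\Theta)+\lambda\|\Theta\|_{1,\mathrm{off}}\big\},$$ the minimum being over symmetric positive semi-definite $p\times p$ matrices $\Theta$ (with $-\log\det\Theta=+\infty$ for singular $\Theta$), where $\|\Theta\|_{1,\mathrm{off}}:=\sum_j\sum_{k\ne j}|\Theta_{j,k}|$. Its KKT-conditions are $\hat\Sigma-\hat\Theta^{-1}+\lambda\hat Z=0$, where $\hat Z$ is symmetric with $\hat Z_{j,j}=0$, $\|\hat Z\|_\infty\le1$, and $\hat Z_{j,k}=\mathrm{sign}(\hat\Theta_{j,k})$ if $j\ne k$ and $\hat\Theta_{j,k}\ne0$; thus $\hat\Theta_{\text{de-sparse}}=\hat\Theta+\lambda\hat\Theta\hat Z\hat\Theta$. *)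

theory Defs
  imports "HOL-Probability.Probability"
begin

(* An n x p matrix (n rows, p columns) is an element of real ^ 'p ^ 'n, with entries A $ row $ column. *)

definition max_entry_norm :: "real ^ 'p ^ 'n \<Rightarrow> real" where
  "max_entry_norm A = Max {\<bar>A $ k $ j\<bar> | k j. True}"

definition max_col_sum_norm :: "real ^ 'p ^ 'n \<Rightarrow> real" where
  "max_col_sum_norm A = Max {(\<Sum>k\<in>UNIV. \<bar>A $ k $ j\<bar>) | j. True}"

definition off_diag_l1_norm :: "real ^ 'p ^ 'p \<Rightarrow> real" where
  "off_diag_l1_norm A = (\<Sum>j\<in>UNIV. \<Sum>k\<in>UNIV - {j}. \<bar>A $ j $ k\<bar>)"

definition sym_pos_semidef :: "real ^ 'p ^ 'p \<Rightarrow> bool" where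
  "sym_pos_semidef A \<longleftrightarrow> transpose A = A \<and> (\<forall>v. 0 \<le> v \<bullet> (A *v v))"

definition neg_log_det :: "real ^ 'p ^ 'p \<Rightarrow> ereal" where
  "neg_log_det A = (if det A = 0 then \<infinity> else ereal (- ln (det A)))"

definition glasso_objective :: "real ^ 'p ^ 'p \<Rightarrow> real \<Rightarrow> real ^ 'p ^ 'p \<Rightarrow> ereal" where
  "glasso_objective S lam \<Theta> =
     ereal (trace (S ** \<Theta>)) + neg_log_det \<Theta> + ereal (lam * off_diag_l1_norm \<Theta>)"

definition is_graphical_lasso :: "real ^ 'p ^ 'p \<Rightarrow> real \<Rightarrow> real ^ 'p ^ 'p \<Rightarrow> bool" where
  "is_graphical_lasso S lam \<Theta> \<longleftrightarrow> is_arg_min (glasso_objective S lam) sym_pos_semidef \<Theta>"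

definition desparsified :: "real ^ 'p ^ 'p \<Rightarrow> real ^ 'p ^ 'p \<Rightarrow> real ^ 'p ^ 'p" where
  "desparsified S \<Theta> = 2 *\<^sub>R \<Theta> - \<Theta> ** S ** \<Theta>"

definition gram_matrix :: "real ^ 'p ^ 'n \<Rightarrow> real ^ 'p ^ 'p" where
  "gram_matrix X = (1 / real CARD('n)) *\<^sub>R (transpose X ** X)"

(* X0^T X0 for a row vector X0, i.e. a 1 x p matrix. *)
definition row_outer :: "real ^ 'p \<Rightarrow> real ^ 'p ^ 'p" where
  "row_outer x = transpose (rowvector x :: real ^ 'p ^ 1) ** (rowvector x :: real ^ 'p ^ 1)"

end

theory Submission
  imports Defs
begin

text \<open>
  Write \<open>D = \<Theta>h - \<Theta>\<^sub>0\<close> and \<open>lam Z = \<Theta>h\<inverse> - \<Sigma>h\<close>. Expanding products gives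
  \<open>2 \<Theta>h - \<Theta>h \<Sigma>h \<Theta>h - \<Theta>\<^sub>0 = - \<Theta>\<^sub>0 W \<Theta>\<^sub>0 - \<Theta>\<^sub>0 W D + lam D Z \<Theta>h\<close>, and the two remainders are bounded
  entrywise, using that \<open>D\<close> is symmetric and that the entries of \<open>Z\<close> are at most 1 in modulus.
  The bound on \<open>Z\<close> is the only part of the KKT conditions that is needed. It follows by comparing
  \<open>\<Theta>h\<close> with its congruence transforms by \<open>1 + t \<Theta>h\<inverse> e\<^sub>i e\<^sub>j\<^sup>T\<close>: these are positive semidefinite for
  every \<open>t\<close>, their determinant is explicit, and they differ from
  \<open>\<Theta>h + t (e\<^sub>i e\<^sub>j\<^sup>T + e\<^sub>j e\<^sub>i\<^sup>T)\<close> only on the diagonal, which the penalty ignores.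
\<close>

section \<open>Ring laws for matrix products and transposes\<close>

lemma matrix_mult_diff_left:
  fixes A :: "'a::ring_1 ^ 'm ^ 'n"
  shows "A ** (B - C) = A ** B - A ** C"
  by (simp add: vec_eq_iff matrix_matrix_mult_def right_diff_distrib sum_subtractf)

lemma matrix_mult_diff_right:
  fixes A :: "'a::ring_1 ^ 'm ^ 'n"
  shows "(A - B) ** C = A ** C - B ** C"
  by (simp add: vec_eq_iff matrix_matrix_mult_def left_diff_distrib sum_subtractf)

lemma matrix_mult_add_right:
  fixes A :: "'a::semiring_1 ^ 'm ^ 'n"
  shows "(A + B) ** C = A ** C + B ** C"
  by (simp add: vec_eq_iff matrix_matrix_mult_def distrib_right sum.distrib)

lemma transpose_add: "transpose (A + B) = transpose A + transpose B"
  by (simp add: vec_eq_iff transpose_def)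

section \<open>Max-entry and column-sum norms\<close>

lemma abs_le_max_entry_norm: "\<bar>A $ i $ j\<bar> \<le> max_entry_norm A"
proof -
  have "{\<bar>A $ k $ j\<bar> | k j. True} = (\<lambda>(k, j). \<bar>A $ k $ j\<bar>) ` UNIV"
    by auto
  then show ?thesis
    unfolding max_entry_norm_def by (intro Max_ge) auto
qed

lemma max_entry_norm_le:
  assumes "\<And>i j. \<bar>A $ i $ j\<bar> \<le> c"
  shows "max_entry_norm A \<le> c"
proof -
  have "{\<bar>A $ k $ j\<bar> | k j. True} = (\<lambda>(k, j). \<bar>A $ k $ j\<bar>) ` UNIV"
    by auto
  then have "finite {\<bar>A $ k $ j\<bar> | k j. True}"
    by simp
  moreover have "{\<bar>A $ k $ j\<bar> | k j. True} \<noteq> {}"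
    by blast
  ultimately show ?thesis
    unfolding max_entry_norm_def using assms by (subst Max_le_iff) auto
qed

lemma col_sum_le_max_col_sum_norm: "(\<Sum>k\<in>UNIV. \<bar>A $ k $ j\<bar>) \<le> max_col_sum_norm A"
proof -
  have "{(\<Sum>k\<in>UNIV. \<bar>A $ k $ j\<bar>) | j. True} = range (\<lambda>j. \<Sum>k\<in>UNIV. \<bar>A $ k $ j\<bar>)"
    by auto
  then show ?thesis
    unfolding max_col_sum_norm_def by (intro Max_ge) auto
qed

text \<open>Hoelder's inequality for row \<open>i\<close> of \<open>A\<close> against column
  \<open>j\<close> of \<open>B\<close>, pairing the sup norm with the l1 norm.\<close>

lemma abs_matrix_mult_entry_le:
  fixes A :: "real ^ 'm ^ 'n"
  assumes "\<And>k. \<bar>A $ i $ k\<bar> \<le> c"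
  shows "\<bar>(A ** B) $ i $ j\<bar> \<le> c * max_col_sum_norm B"
proof -
  have "0 \<le> c"
    using assms[of undefined] by linarith
  have "\<bar>(A ** B) $ i $ j\<bar> \<le> (\<Sum>k\<in>UNIV. \<bar>A $ i $ k * B $ k $ j\<bar>)"
    unfolding matrix_matrix_mult_def by (simp add: sum_abs)
  also have "\<dots> \<le> (\<Sum>k\<in>UNIV. c * \<bar>B $ k $ j\<bar>)"
    unfolding abs_mult by (intro sum_mono mult_right_mono assms) auto
  also have "\<dots> \<le> c * max_col_sum_norm B"
    unfolding sum_distrib_left[symmetric]
    by (intro mult_left_mono col_sum_le_max_col_sum_norm \<open>0 \<le> c\<close>)
  finally show ?thesis .
qed

lemma max_entry_norm_mult_le:
  fixes A :: "real ^ 'm ^ 'n"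
  shows "max_entry_norm (A ** B) \<le> max_entry_norm A * max_col_sum_norm B"
  by (intro max_entry_norm_le abs_matrix_mult_entry_le abs_le_max_entry_norm)

text \<open>Transposing the product puts \<open>A\<close> on the right, where the preceding entry
  bound applies. Symmetry is what turns the row sums of \<open>A\<close>, which naturally occur
  here, into column sums.\<close>

lemma max_entry_norm_symmetric_mult_le:
  fixes A B :: "real ^ 'p ^ 'p"
  assumes "transpose A = A"
  shows "max_entry_norm (A ** B) \<le> max_col_sum_norm A * max_entry_norm B"
proof (rule max_entry_norm_le)
  fix i j
  have "(A ** B) $ i $ j = (transpose B ** A) $ j $ i"
    using arg_cong[OF matrix_transpose_mul[of A B], of "\<lambda>C. C $ j $ i"]
    by (simp add: assms) (simp add: transpose_def)
  also have "\<bar>\<dots>\<bar> \<le> max_entry_norm B * max_col_sum_norm A"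
    by (rule abs_matrix_mult_entry_le) (simp add: transpose_def abs_le_max_entry_norm)
  finally show "\<bar>(A ** B) $ i $ j\<bar> \<le> max_col_sum_norm A * max_entry_norm B"
    by (simp add: mult.commute)
qed

lemma max_entry_norm_uminus: "max_entry_norm (- A) = max_entry_norm A"
  by (simp add: max_entry_norm_def)

lemma max_col_sum_norm_nonneg: "0 \<le> max_col_sum_norm A"
  by (rule order_trans[OF _ col_sum_le_max_col_sum_norm[of A undefined]]) (simp add: sum_nonneg)

section \<open>Inverses and symmetry\<close>

lemma matrix_inv_mult:
  fixes A :: "real ^ 'p ^ 'p"
  assumes "invertible A"
  shows "A ** matrix_inv A = mat 1" and "matrix_inv A ** A = mat 1"
  using someI_ex[OF assms[unfolded invertible_def]] unfolding matrix_inv_def by auto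

lemma transpose_matrix_inv_eq:
  fixes A :: "real ^ 'p ^ 'p"
  assumes "invertible A" "transpose A = A"
  shows "transpose (matrix_inv A) = matrix_inv A"
proof -
  have "transpose (matrix_inv A) ** A = mat 1"
    by (metis assms matrix_inv_mult(1) matrix_transpose_mul transpose_mat)
  then show ?thesis
    by (metis assms(1) matrix_inv_mult(1) matrix_mul_assoc matrix_mul_lid matrix_mul_rid)
qed

lemma transpose_row_outer: "transpose (row_outer x) = row_outer x"
  by (simp add: row_outer_def matrix_transpose_mul)

lemma transpose_gram_matrix: "transpose (gram_matrix X) = gram_matrix X"
  by (simp add: gram_matrix_def matrix_transpose_mul transpose_scalar)

text \<open>Transposition is linear, hence bounded in finite dimension, and so commutes with the
  integral. This carries symmetry over to the second-moment matrix.\<close>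

lemma transpose_lebesgue_integral:
  fixes f :: "'a \<Rightarrow> real ^ 'm ^ 'n"
  assumes "integrable M f"
  shows "(LINT x|M. transpose (f x)) = transpose (LINT x|M. f x)"
proof -
  have "linear (transpose :: real ^ 'm ^ 'n \<Rightarrow> _)"
    by (intro linearI) (simp_all add: transpose_add transpose_scalar)
  then show ?thesis
    by (intro integral_bounded_linear assms) (simp add: linear_conv_bounded_linear)
qed

section \<open>Feasible perturbations by congruence\<close>

text \<open>The quadratic form of the transform at \<open>v\<close> is that of \<open>A\<close> at
  \<open>G *v v\<close>.\<close>

lemma sym_pos_semidef_congruence:
  assumes "sym_pos_semidef A"
  shows "sym_pos_semidef (transpose G ** A ** G)"
  unfolding sym_pos_semidef_def
proof (intro conjI allI)
  show "transpose (transpose G ** A ** G) = transpose G ** A ** G"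
    using assms by (simp add: sym_pos_semidef_def matrix_transpose_mul matrix_mul_assoc)
next
  fix v
  have "v \<bullet> ((transpose G ** A ** G) *v v) = v \<bullet> (transpose G *v (A *v (G *v v)))"
    by (simp only: matrix_vector_mul_assoc matrix_mul_assoc)
  also have "\<dots> = (G *v v) \<bullet> (A *v (G *v v))"
    by (metis dot_lmul_matrix vector_transpose_matrix)
  also have "\<dots> \<ge> 0"
    using assms by (simp add: sym_pos_semidef_def)
  finally show "0 \<le> v \<bullet> ((transpose G ** A ** G) *v v)" .
qed

definition matrix_unit :: "'n \<Rightarrow> 'm \<Rightarrow> real ^ 'm ^ 'n" where
  "matrix_unit i j = (\<chi> a b. if a = i \<and> b = j then 1 else 0)"

lemma matrix_unit_nonneg: "0 \<le> matrix_unit i j $ a $ b"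
  by (simp add: matrix_unit_def)

lemma matrix_mult_unit: "(A ** matrix_unit i j) $ a $ b = (if b = j then A $ a $ i else 0)"
  by (auto simp: matrix_matrix_mult_def matrix_unit_def if_distrib[of "\<lambda>x. _ * x"] cong: if_cong)

lemma transpose_matrix_unit: "transpose (matrix_unit i j) = matrix_unit j i"
  by (auto simp: vec_eq_iff transpose_def matrix_unit_def)

lemma unit_mult_matrix: "(matrix_unit i j ** A) $ a $ b = (if a = i then A $ j $ b else 0)"
  by (auto simp: matrix_matrix_mult_def matrix_unit_def if_distrib[of "\<lambda>x. x * _"] cong: if_cong)

lemma trace_mult_unit: "trace (A ** matrix_unit i j) = A $ j $ i"
  by (simp add: trace_def matrix_mult_unit)

lemma trace_scaleR:
  fixes A :: "real ^ 'p ^ 'p"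
  shows "trace (c *\<^sub>R A) = c * trace A"
  by (simp add: trace_def sum_distrib_left)

text \<open>The matrix is the identity with column \<open>j\<close> replaced by \<open>x\<close>, so
  Cramer's lemma gives the determinant as the entry \<open>x $ j\<close>.\<close>

lemma det_one_plus_mult_unit:
  fixes P :: "real ^ 'p ^ 'p"
  shows "det (mat 1 + t *\<^sub>R (P ** matrix_unit i j)) = 1 + t * P $ j $ i"
proof -
  define x :: "real ^ 'p" where "x = (\<chi> a. (if a = j then 1 else 0) + t * P $ a $ i)"
  have "mat 1 + t *\<^sub>R (P ** matrix_unit i j)
      = (\<chi> a b. if b = j then (mat 1 *v x) $ a else mat 1 $ a $ b)"
    unfolding matrix_vector_mul_lid by (auto simp: vec_eq_iff matrix_mult_unit mat_def x_def)
  then have "det (mat 1 + t *\<^sub>R (P ** matrix_unit i j)) = x $ j * det (mat 1 :: real ^ 'p ^ 'p)"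
    by (simp only: cramer_lemma)
  then show ?thesis
    by (simp add: x_def)
qed

text \<open>In the terms linear in \<open>t\<close>, \<open>P\<close> cancels against
  \<open>A\<close>. The term of order two is \<open>E\<^sub>j\<^sub>i P E\<^sub>i\<^sub>j\<close>,
  writing \<open>E\<close> for matrix units, and it sits in the single diagonal position
  \<open>(j, j)\<close>.\<close>

lemma congruence_by_one_plus_unit:
  fixes A P :: "real ^ 'p ^ 'p" and i j :: 'p and t :: real
  assumes "A ** P = mat 1" "transpose P = P" "transpose A = A"
  defines "G \<equiv> mat 1 + t *\<^sub>R (P ** matrix_unit i j)"
  shows "transpose G ** A ** G
    = A + t *\<^sub>R (matrix_unit i j + matrix_unit j i) + (t\<^sup>2 * P $ i $ i) *\<^sub>R matrix_unit j j"
proof -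
  have PA: "P ** A = mat 1"
    using assms(1) matrix_left_right_inverse by blast
  have AG: "A ** G = A + t *\<^sub>R matrix_unit i j"
    by (simp add: G_def matrix_add_ldistrib matrix_scalar_ac matrix_mul_assoc assms
        flip: scalar_matrix_assoc)
  have GT: "transpose G = mat 1 + t *\<^sub>R (matrix_unit j i ** P)"
    by (simp add: G_def transpose_add transpose_scalar matrix_transpose_mul transpose_matrix_unit
        assms)
  have "matrix_unit j i ** P ** matrix_unit i j = P $ i $ i *\<^sub>R matrix_unit j j"
    by (auto simp: vec_eq_iff matrix_mult_unit unit_mult_matrix)
      (simp_all add: matrix_unit_def)
  moreover have "matrix_unit j i ** P ** A = matrix_unit j i"
    by (simp add: PA flip: matrix_mul_assoc)
  ultimately show ?thesis
    unfolding matrix_mul_assoc[symmetric] AG GT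
    by (simp add: matrix_add_ldistrib matrix_mult_add_right matrix_scalar_ac matrix_mul_assoc
        power2_eq_square algebra_simps flip: scalar_matrix_assoc)
qed

text \<open>Triangle inequality off the diagonal, where the last summand vanishes. The factor 2 is
  the sum of all entries of the two matrix units; for \<open>i = j\<close> the bound is crude but
  still valid.\<close>

lemma off_diag_l1_norm_perturbed_le:
  fixes A :: "real ^ 'p ^ 'p"
  shows "off_diag_l1_norm (A + t *\<^sub>R (matrix_unit i j + matrix_unit j i) + s *\<^sub>R matrix_unit k k)
    \<le> off_diag_l1_norm A + 2 * \<bar>t\<bar>" (is "off_diag_l1_norm ?B \<le> _")
proof -
  define E :: "real ^ 'p ^ 'p" where "E = matrix_unit i j + matrix_unit j i"
  have E_nonneg: "0 \<le> E $ a $ b" for a b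
    by (simp add: E_def matrix_unit_nonneg)
  have E_sum: "(\<Sum>a\<in>UNIV. \<Sum>b\<in>UNIV. E $ a $ b) = 2"
  proof -
    have "(\<Sum>b\<in>UNIV. matrix_unit i j $ a $ b) = (if a = i then 1 else 0)" for a i j :: 'p
      by (cases "a = i") (simp_all add: matrix_unit_def)
    then show ?thesis
      by (simp add: E_def sum.distrib)
  qed
  have entry: "\<bar>?B $ a $ b\<bar> \<le> \<bar>A $ a $ b\<bar> + \<bar>t\<bar> * E $ a $ b" if "a \<noteq> b" for a b
  proof -
    have "matrix_unit k k $ a $ b = 0"
      using that by (cases "a = k") (simp_all add: matrix_unit_def)
    then have "?B $ a $ b = A $ a $ b + t * E $ a $ b"
      by (simp add: E_def)
    then show ?thesis
      using abs_triangle_ineq[of "A $ a $ b" "t * E $ a $ b"] E_nonneg[of a b]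
      by (simp add: abs_mult)
  qed
  have "off_diag_l1_norm ?B
      \<le> (\<Sum>a\<in>UNIV. \<Sum>b\<in>UNIV - {a}. \<bar>A $ a $ b\<bar> + \<bar>t\<bar> * E $ a $ b)"
    unfolding off_diag_l1_norm_def by (intro sum_mono entry) simp
  also have "\<dots> = off_diag_l1_norm A + \<bar>t\<bar> * (\<Sum>a\<in>UNIV. \<Sum>b\<in>UNIV - {a}. E $ a $ b)"
    by (simp add: off_diag_l1_norm_def sum.distrib sum_distrib_left)
  also have "\<dots> \<le> off_diag_l1_norm A + \<bar>t\<bar> * (\<Sum>a\<in>UNIV. \<Sum>b\<in>UNIV. E $ a $ b)"
    by (intro add_left_mono mult_left_mono sum_mono sum_mono2) (simp_all add: E_nonneg)
  finally show ?thesis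
    by (simp add: E_sum mult.commute)
qed

section \<open>First-order optimality of the graphical Lasso\<close>

lemma slope_nonneg_if_quadratic_nonneg:
  fixes b C \<delta> :: real
  assumes "0 < \<delta>" and "\<And>t. 0 < t \<Longrightarrow> t < \<delta> \<Longrightarrow> 0 \<le> b * t + C * t\<^sup>2"
  shows "0 \<le> b"
proof (rule tendsto_lowerbound)
  show "((\<lambda>t. b + C * t) \<longlongrightarrow> b) (at_right 0)"
    by (auto intro!: tendsto_eq_intros)
  have "0 \<le> b + C * t" if "0 < t" "t < \<delta>" for t
  proof -
    have "0 \<le> t * (b + C * t)"
      using assms(2)[OF that] by (simp add: algebra_simps power2_eq_square)
    then show ?thesis
      using that by (simp add: zero_le_mult_iff)
  qed
  then show "\<forall>\<^sub>F t in at_right 0. 0 \<le> b + C * t"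
    using assms(1) by (auto simp: eventually_at_right_field)
qed simp

text \<open>A singular matrix has objective value \<infinity>, whereas the identity is feasible with
  a finite value.\<close>

lemma graphical_lasso_det_nonzero:
  assumes "is_graphical_lasso S lam \<Theta>"
  shows "det \<Theta> \<noteq> 0"
proof
  assume "det \<Theta> = 0"
  moreover have "sym_pos_semidef (mat 1)"
    by (simp add: sym_pos_semidef_def)
  moreover have "glasso_objective S lam (mat 1) < \<infinity>"
    by (simp add: glasso_objective_def neg_log_det_def)
  ultimately show False
    using assms
    by (auto simp: is_graphical_lasso_def is_arg_min_def glasso_objective_def neg_log_det_def)
qed

text \<open>Along the congruence curve the smooth part has slope \<open>2 * (q - p)\<close> at 0,
  and the penalty grows by at most \<open>2 * lam * \<bar>t\<bar>\<close>. Minimality from both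
  sides of 0 therefore bounds \<open>\<bar>p - q\<bar>\<close>. The case \<open>i = j\<close> is
  included.\<close>

lemma graphical_lasso_kkt_bound:
  fixes S \<Theta> P :: "real ^ 'p ^ 'p"
  assumes lasso: "is_graphical_lasso S lam \<Theta>" and lam: "0 \<le> lam"
    and S: "transpose S = S" and P: "\<Theta> ** P = mat 1" "transpose P = P"
  shows "\<bar>P $ i $ j - S $ i $ j\<bar> \<le> lam"
proof -
  have psd: "sym_pos_semidef \<Theta>"
    using lasso by (simp add: is_graphical_lasso_def is_arg_min_def)
  then have \<Theta>: "transpose \<Theta> = \<Theta>"
    by (simp add: sym_pos_semidef_def)
  note det = graphical_lasso_det_nonzero[OF lasso]
  define p q where "p = P $ i $ j" and "q = S $ i $ j"
  have sym: "P $ j $ i = p" "S $ j $ i = q"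
    using arg_cong[OF P(2), of "\<lambda>A. A $ i $ j"] arg_cong[OF S, of "\<lambda>A. A $ i $ j"]
    by (simp_all add: p_def q_def transpose_def)
  \<comment> \<open>The second-order cost: the first summand is the trace of the diagonal correction
    against \<open>S\<close>, the second comes from doubling the error
    \<open>2 * (t * p)\<^sup>2\<close> in the lower bound for \<open>ln (1 + t * p)\<close>.\<close>
  define C where "C = P $ i $ i * S $ j $ j + 4 * p\<^sup>2"
  have expansion: "0 \<le> 2 * t * (q - p) + 2 * lam * \<bar>t\<bar> + C * t\<^sup>2" if t: "\<bar>t * p\<bar> \<le> 1 / 2" for t
  proof -
    define G where "G = mat 1 + t *\<^sub>R (P ** matrix_unit i j)"
    define \<Theta>t where "\<Theta>t = transpose G ** \<Theta> ** G"
    have \<Theta>t: "\<Theta>t = \<Theta> + t *\<^sub>R (matrix_unit i j + matrix_unit j i)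
        + (t\<^sup>2 * P $ i $ i) *\<^sub>R matrix_unit j j"
      unfolding \<Theta>t_def G_def by (rule congruence_by_one_plus_unit[OF P \<Theta>])
    have "sym_pos_semidef \<Theta>t"
      unfolding \<Theta>t_def by (rule sym_pos_semidef_congruence[OF psd])
    then have min: "glasso_objective S lam \<Theta> \<le> glasso_objective S lam \<Theta>t"
      using lasso by (auto simp: is_graphical_lasso_def is_arg_min_def not_less)
    have "det G = 1 + t * p"
      by (simp add: G_def det_one_plus_mult_unit sym)
    then have det_t: "det \<Theta>t = det \<Theta> * (1 + t * p)\<^sup>2"
      by (simp add: \<Theta>t_def det_mul power2_eq_square)
    have pos: "1 + t * p \<noteq> 0"
      using t by (simp add: abs_if split: if_splits)
    \<comment> \<open>Since \<open>ln (- x) = ln x\<close> in HOL, the sign of \<open>det \<Theta>\<close> plays no role.\<close>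
    have ln_t: "ln (det \<Theta>t) = ln (det \<Theta>) + 2 * ln (1 + t * p)"
      using det pos by (simp add: det_t ln_mult ln_realpow)
    have tr_t: "trace (S ** \<Theta>t) = trace (S ** \<Theta>) + 2 * t * q + t\<^sup>2 * P $ i $ i * S $ j $ j"
      by (simp add: \<Theta>t matrix_add_ldistrib matrix_scalar_ac trace_add trace_scaleR trace_mult_unit sym
          flip: scalar_matrix_assoc q_def)
    have "trace (S ** \<Theta>) - ln (det \<Theta>) + lam * off_diag_l1_norm \<Theta>
        \<le> trace (S ** \<Theta>t) - ln (det \<Theta>t) + lam * off_diag_l1_norm \<Theta>t"
      using min det pos by (simp add: glasso_objective_def neg_log_det_def det_t)
    moreover have "lam * off_diag_l1_norm \<Theta>t \<le> lam * (off_diag_l1_norm \<Theta> + 2 * \<bar>t\<bar>)"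
      unfolding \<Theta>t using lam by (intro mult_left_mono off_diag_l1_norm_perturbed_le)
    moreover have "t * p - 2 * (t * p)\<^sup>2 \<le> ln (1 + t * p)"
      using abs_ln_one_plus_x_minus_x_bound[OF t] by linarith
    ultimately show ?thesis
      by (simp add: ln_t tr_t C_def algebra_simps power_mult_distrib)
  qed
  \<comment> \<open>Small enough for the range of the logarithm bound; the added 1 avoids division
    by zero when \<open>p = 0\<close>.\<close>
  define \<delta> where "\<delta> = 1 / (2 * (\<bar>p\<bar> + 1))"
  have "0 < \<delta>"
    by (simp add: \<delta>_def)
  have small: "\<bar>t * p\<bar> \<le> 1 / 2" if "0 < t" "t < \<delta>" for t
  proof -
    have "t * (2 * (\<bar>p\<bar> + 1)) < 1"
      using that(2) by (simp add: \<delta>_def field_simps)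
    then show ?thesis
      using that(1) by (simp add: abs_mult algebra_simps)
  qed
  have "0 \<le> 2 * (q - p) + 2 * lam"
  proof (rule slope_nonneg_if_quadratic_nonneg[OF \<open>0 < \<delta>\<close>, of _ C])
    fix t :: real
    assume "0 < t" "t < \<delta>"
    then show "0 \<le> (2 * (q - p) + 2 * lam) * t + C * t\<^sup>2"
      using expansion[of t] small[of t] by (simp add: algebra_simps)
  qed
  \<comment> \<open>The opposite direction \<open>- t\<close> flips the linear term but not the
    penalty bound.\<close>
  moreover have "0 \<le> 2 * (p - q) + 2 * lam"
  proof (rule slope_nonneg_if_quadratic_nonneg[OF \<open>0 < \<delta>\<close>, of _ C])
    fix t :: real
    assume "0 < t" "t < \<delta>"
    then show "0 \<le> (2 * (p - q) + 2 * lam) * t + C * t\<^sup>2"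
      using expansion[of "- t"] small[of t] by (simp add: algebra_simps)
  qed
  ultimately show ?thesis
    by (simp add: p_def q_def abs_le_iff)
qed

section \<open>Error expansion and remainder bounds\<close>

text \<open>The first two products on the right add up to
  \<open>\<Theta> - \<Theta>\<^sub>0 ** S ** \<Theta>\<close>, and the last contributes
  \<open>\<Theta> - \<Theta>\<^sub>0 - (\<Theta> - \<Theta>\<^sub>0) ** S ** \<Theta>\<close>. The
  double minus displays the second remainder as a negated product.\<close>

lemma desparsified_expansion:
  fixes S \<Theta> \<Sigma>\<^sub>0 \<Theta>\<^sub>0 P :: "real ^ 'p ^ 'p"
  assumes "P ** \<Theta> = mat 1" "\<Theta>\<^sub>0 ** \<Sigma>\<^sub>0 = mat 1"
  shows "desparsified S \<Theta> - \<Theta>\<^sub>0 = - (\<Theta>\<^sub>0 ** (S - \<Sigma>\<^sub>0) ** \<Theta>\<^sub>0)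
    - \<Theta>\<^sub>0 ** (S - \<Sigma>\<^sub>0) ** (\<Theta> - \<Theta>\<^sub>0) - - ((\<Theta> - \<Theta>\<^sub>0) ** (P - S) ** \<Theta>)"
proof -
  have "A ** P ** \<Theta> = A" for A :: "real ^ 'p ^ 'p"
    by (metis assms(1) matrix_mul_assoc matrix_mul_rid)
  then show ?thesis
    by (simp add: desparsified_def matrix_mult_diff_left matrix_mult_diff_right assms scaleR_2)
qed

text \<open>The deterministic core, for a fixed symmetric \<open>S\<close>. The remainders are read
  off from the expansion; the second is bounded by peeling off \<open>\<Theta>\<close> on the right
  and the symmetric difference on the left, leaving \<open>P - S\<close> for the KKT bound.\<close>

lemma graphical_lasso_expansion:
  fixes S \<Theta> \<Sigma>\<^sub>0 :: "real ^ 'p ^ 'p"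
  assumes lasso: "is_graphical_lasso S lam \<Theta>" and lam: "0 \<le> lam"
    and S: "transpose S = S"
    and \<Sigma>\<^sub>0: "invertible \<Sigma>\<^sub>0" "transpose \<Sigma>\<^sub>0 = \<Sigma>\<^sub>0"
  defines "\<Theta>\<^sub>0 \<equiv> matrix_inv \<Sigma>\<^sub>0"
  shows "\<exists>R\<^sub>1 R\<^sub>2. desparsified S \<Theta> - \<Theta>\<^sub>0 = - (\<Theta>\<^sub>0 ** (S - \<Sigma>\<^sub>0) ** \<Theta>\<^sub>0) - R\<^sub>1 - R\<^sub>2 \<and>
    max_entry_norm R\<^sub>1 \<le> max_entry_norm (\<Theta>\<^sub>0 ** (S - \<Sigma>\<^sub>0)) * max_col_sum_norm (\<Theta> - \<Theta>\<^sub>0) \<and>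
    max_entry_norm R\<^sub>2 \<le> lam * max_col_sum_norm \<Theta> * max_col_sum_norm (\<Theta> - \<Theta>\<^sub>0)"
proof -
  have \<Theta>: "transpose \<Theta> = \<Theta>"
    using lasso by (simp add: is_graphical_lasso_def is_arg_min_def sym_pos_semidef_def)
  have inv: "invertible \<Theta>"
    using graphical_lasso_det_nonzero[OF lasso] by (simp add: invertible_det_nz)
  define P where "P = matrix_inv \<Theta>"
  have P: "\<Theta> ** P = mat 1" "P ** \<Theta> = mat 1" "transpose P = P"
    unfolding P_def by (simp_all add: matrix_inv_mult inv transpose_matrix_inv_eq \<Theta>)
  have D: "transpose (\<Theta> - \<Theta>\<^sub>0) = \<Theta> - \<Theta>\<^sub>0"
    using \<Theta> transpose_matrix_inv_eq[OF \<Sigma>\<^sub>0]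
    by (simp add: \<Theta>\<^sub>0_def vec_eq_iff transpose_def)
  have "max_entry_norm (P - S) \<le> lam"
    using graphical_lasso_kkt_bound[OF lasso lam S P(1,3)] by (intro max_entry_norm_le) simp
  have "max_entry_norm ((\<Theta> - \<Theta>\<^sub>0) ** (P - S) ** \<Theta>)
      \<le> max_entry_norm ((\<Theta> - \<Theta>\<^sub>0) ** (P - S)) * max_col_sum_norm \<Theta>"
    by (rule max_entry_norm_mult_le)
  also have "\<dots> \<le> (max_col_sum_norm (\<Theta> - \<Theta>\<^sub>0) * max_entry_norm (P - S)) * max_col_sum_norm \<Theta>"
    by (intro mult_right_mono max_entry_norm_symmetric_mult_le D max_col_sum_norm_nonneg)
  also have "\<dots> \<le> (max_col_sum_norm (\<Theta> - \<Theta>\<^sub>0) * lam) * max_col_sum_norm \<Theta>"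
    by (intro mult_right_mono mult_left_mono max_col_sum_norm_nonneg
        \<open>max_entry_norm (P - S) \<le> lam\<close>)
  finally have "max_entry_norm (- ((\<Theta> - \<Theta>\<^sub>0) ** (P - S) ** \<Theta>))
      \<le> lam * max_col_sum_norm \<Theta> * max_col_sum_norm (\<Theta> - \<Theta>\<^sub>0)"
    by (simp add: max_entry_norm_uminus ac_simps)
  moreover have "\<Theta>\<^sub>0 ** \<Sigma>\<^sub>0 = mat 1"
    unfolding \<Theta>\<^sub>0_def by (rule matrix_inv_mult(2)[OF \<Sigma>\<^sub>0(1)])
  ultimately show ?thesis
    using desparsified_expansion[OF P(2)] max_entry_norm_mult_le by blast
qed

theorem lemma2p6p3:
  fixes M :: "'w measure" and N :: "'v measure"
    and X :: "'w \<Rightarrow> real ^ 'p ^ 'n" and X\<^sub>0 :: "'v \<Rightarrow> real ^ 'p"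
    and \<Sigma>h W \<Theta>h :: "'w \<Rightarrow> real ^ 'p ^ 'p"
    and \<Sigma>\<^sub>0 \<Theta>\<^sub>0 :: "real ^ 'p ^ 'p"
    and lam :: real
  assumes "prob_space M" and "prob_space N"
    and "X \<in> borel_measurable M" and "X\<^sub>0 \<in> borel_measurable N"
    and "prob_space.indep_vars M (\<lambda>i. borel) (\<lambda>i \<omega>. X \<omega> $ i) UNIV"
    and "\<And>i. distr M borel (\<lambda>\<omega>. X \<omega> $ i) = distr N borel X\<^sub>0"
    and "integrable N (\<lambda>\<omega>. row_outer (X\<^sub>0 \<omega>))"
    and "\<And>\<omega>. \<Sigma>h \<omega> = gram_matrix (X \<omega>)"
    and "\<Sigma>\<^sub>0 = (LINT \<omega>|N. row_outer (X\<^sub>0 \<omega>))"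
    and "\<And>\<omega>. W \<omega> = \<Sigma>h \<omega> - \<Sigma>\<^sub>0"
    and "invertible \<Sigma>\<^sub>0" and "\<Theta>\<^sub>0 = matrix_inv \<Sigma>\<^sub>0"
    and "lam > 0"
  shows "\<exists>rem\<^sub>1 rem\<^sub>2 :: 'w \<Rightarrow> real ^ 'p ^ 'p. \<forall>\<omega>\<in>space M.
           is_graphical_lasso (\<Sigma>h \<omega>) lam (\<Theta>h \<omega>) \<longrightarrow>
             desparsified (\<Sigma>h \<omega>) (\<Theta>h \<omega>) - \<Theta>\<^sub>0
               = - (\<Theta>\<^sub>0 ** W \<omega> ** \<Theta>\<^sub>0) - rem\<^sub>1 \<omega> - rem\<^sub>2 \<omega> \<and>
             max_entry_norm (rem\<^sub>1 \<omega>)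
               \<le> max_entry_norm (\<Theta>\<^sub>0 ** W \<omega>) * max_col_sum_norm (\<Theta>h \<omega> - \<Theta>\<^sub>0) \<and>
             max_entry_norm (rem\<^sub>2 \<omega>)
               \<le> lam * max_col_sum_norm (\<Theta>h \<omega>) * max_col_sum_norm (\<Theta>h \<omega> - \<Theta>\<^sub>0)"
proof -
  have "transpose \<Sigma>\<^sub>0 = \<Sigma>\<^sub>0"
    using transpose_lebesgue_integral[OF assms(7)] by (simp add: assms(9) transpose_row_outer)
  \<comment> \<open>The Lasso assumption stays inside the existential, so that remainders exist at
    every sample point and can be chosen as functions of it.\<close>
  then have "\<exists>R\<^sub>1 R\<^sub>2. is_graphical_lasso (\<Sigma>h \<omega>) lam (\<Theta>h \<omega>) \<longrightarrow>
      desparsified (\<Sigma>h \<omega>) (\<Theta>h \<omega>) - \<Theta>\<^sub>0 = - (\<Theta>\<^sub>0 ** W \<omega> ** \<Theta>\<^sub>0) - R\<^sub>1 - R\<^sub>2 \<and>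
      max_entry_norm R\<^sub>1 \<le> max_entry_norm (\<Theta>\<^sub>0 ** W \<omega>) * max_col_sum_norm (\<Theta>h \<omega> - \<Theta>\<^sub>0) \<and>
      max_entry_norm R\<^sub>2 \<le> lam * max_col_sum_norm (\<Theta>h \<omega>) * max_col_sum_norm (\<Theta>h \<omega> - \<Theta>\<^sub>0)"
    for \<omega>
    using graphical_lasso_expansion[of "\<Sigma>h \<omega>" lam "\<Theta>h \<omega>" \<Sigma>\<^sub>0] assms(8,10-13)
    by (simp add: transpose_gram_matrix)
  then show ?thesis
    by metis
qed

end
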